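(* Let $\alpha_{\mathrm{sig}},\alpha_{\mathrm{spec}},\alpha_{\mathrm{path}},\alpha_{\mathrm{pool}}\ge 0$. Then the composite kernel $k_{\mathrm{CPDA}}:\mathcal X\times\mathcal X\to\mathbb R$, $$k_{\mathrm{CPDA}}(x,x')=\alpha_{\mathrm{sig}}k_{\mathrm{sig}}(x,x')+\alpha_{\mathrm{spec}}k_{\mathrm{spec}}(x,x')+\alpha_{\mathrm{path}}k_{\mathrm{path}}(x,x')+\alpha_{\mathrm{pool}}k_{\mathrm{pool}}(x,x'),$$ is a positive semidefinite kernel on $\mathcal X$.
   Context: Input space $\mathcal X\subseteq\mathbb R^{C_{\mathrm{in}}\times L}$. A fixed feature extractor maps $x\in\mathcal X$ to a latent path $Z_\theta(x)=(z_1,\dots,z_T)$, $z_t\in\mathbb R^d$. Put $\Delta z_t=z_t-z_{t-1}$ for $t\ge2$, $\Delta z_1=0$, and $A_\theta(x)_t=[t/T,\,z_t,\,\Delta z_t]\in\mathbb R^{2d+1}$. The four representations are: - pooled: $\psi_{\mathrm{pool}}(x)=\frac1T\sum_{t=1}^T z_t$; - path: $\psi_{\mathrm{path}}(x)=\mathrm{vec}(A_\theta(x)_1,\dots,A_\theta(x)_T)$; - spectral: $\psi_{\mathrm{spec}}(x)=\mathrm{vec}\big(\log(1+|\mathcal F_t[Z_\theta(x)]|^2)\big)$, where $\mathcal F_t$ is the discrete Fourier transform along the time index applied to each of the $d$ channels, and $|\cdot|^2$ and $\log$ act entrywise; - signature: with $\widetilde Z_\theta(x)_t=[t/T,z_t]\in\mathbb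 R^{d+1}$, a fixed matrix $P\in\mathbb R^{r\times(d+1)}$ and $u_t=P(\widetilde Z_\theta(x)_{t+1}-\widetilde Z_\theta(x)_t)$ for $1\le t\le T-1$, set $S_1(x)=\sum_{t=1}^{T-1}u_t$, $S_2(x)=\sum_{1\le i<j\le T-1}u_i\otimes u_j$, and $\psi_{\mathrm{sig}}(x)=[S_1(x),\mathrm{vec}(S_2(x))]$. For $a\in\{\mathrm{pool},\mathrm{path},\mathrm{spec},\mathrm{sig}\}$, $\overline\psi_a(x)$ denotes the $\ell_2$-normalized vector $\psi_a(x)/\|\psi_a(x)\|_2$ (with any fixed convention, e.g. $0$, when $\psi_a(x)=0$), and $$k_a(x,x')=\frac1M\sum_{m=1}^M\exp\Big(-\frac{\|\overline\psi_a(x)-\overline\psi_a(x')\|_2^2}{\sigma_{a,m}^2}\Big)$$ with fixed $M\ge1$ and bandwidths $\sigma_{a,m}>0$ ($M=1$ is the single Gaussian kernel). A symmetric function $k$ is a positive semidefinite kernel if $\sum_{i,j}c_ic_jk(x_i,x_j)\ge0$ for all finite families of points $x_i\in\mathcal X$ and reals $c_i$. *)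

theory Defs
  imports Complex_Main "Jordan_Normal_Form.Matrix"
begin

(* A latent path (z_1, ..., z_T) in R^d is a function z :: nat => real vec, read only at the time
   indices 1..T.  Vector and matrix entries are indexed from 0, as usual for real vec, real mat. *)

(* column-stacking vec operator *)
definition vectorize :: "real mat \<Rightarrow> real vec" where
  "vectorize A =
     vec (dim_row A * dim_col A) (\<lambda>i. A $$ (i mod dim_row A, i div dim_row A))"

definition l2_norm :: "real vec \<Rightarrow> real" where
  "l2_norm v = sqrt (v \<bullet> v)"

definition pooled :: "nat \<Rightarrow> nat \<Rightarrow> (nat \<Rightarrow> real vec) \<Rightarrow> real vec" where
  "pooled d T z = vec d (\<lambda>c. (1 / real T) * (\<Sum>t=1..T. z t $ c))"

definition path_increment :: "nat \<Rightarrow> (nat \<Rightarrow> real vec) \<Rightarrow> nat \<Rightarrow> real vec" where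
  "path_increment d z t = (if t = 1 then 0\<^sub>v d else z t - z (t - 1))"

definition augmented_path :: "nat \<Rightarrow> nat \<Rightarrow> (nat \<Rightarrow> real vec) \<Rightarrow> nat \<Rightarrow> real vec" where
  "augmented_path d T z t = vCons (real t / real T) (z t @\<^sub>v path_increment d z t)"

definition path_rep :: "nat \<Rightarrow> nat \<Rightarrow> (nat \<Rightarrow> real vec) \<Rightarrow> real vec" where
  "path_rep d T z =
     vectorize (mat_of_cols (2 * d + 1) (map (augmented_path d T z) [1..<T + 1]))"

(* Unnormalised DFT in time: entry (c, k) is the coefficient of channel c at frequency k < T;
   time 1 has phase 0. *)
definition dft :: "nat \<Rightarrow> nat \<Rightarrow> (nat \<Rightarrow> real vec) \<Rightarrow> complex mat" where
  "dft d T z = mat d T (\<lambda>(c, k).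
     \<Sum>t=1..T. complex_of_real (z t $ c) * cis (- 2 * pi * real k * real (t - 1) / real T))"

definition spectral_rep :: "nat \<Rightarrow> nat \<Rightarrow> (nat \<Rightarrow> real vec) \<Rightarrow> real vec" where
  "spectral_rep d T z = vectorize (map_mat (\<lambda>w. ln (1 + (cmod w)\<^sup>2)) (dft d T z))"

definition time_augmented :: "nat \<Rightarrow> (nat \<Rightarrow> real vec) \<Rightarrow> nat \<Rightarrow> real vec" where
  "time_augmented T z t = vCons (real t / real T) (z t)"

definition sig_increment :: "nat \<Rightarrow> real mat \<Rightarrow> (nat \<Rightarrow> real vec) \<Rightarrow> nat \<Rightarrow> real vec" where
  "sig_increment T P z t = P *\<^sub>v (time_augmented T z (t + 1) - time_augmented T z t)"

definition sig1 :: "nat \<Rightarrow> real mat \<Rightarrow> (nat \<Rightarrow> real vec) \<Rightarrow> real vec" where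
  "sig1 T P z = vec (dim_row P) (\<lambda>p. \<Sum>t=1..T - 1. sig_increment T P z t $ p)"

definition sig2 :: "nat \<Rightarrow> real mat \<Rightarrow> (nat \<Rightarrow> real vec) \<Rightarrow> real mat" where
  "sig2 T P z = mat (dim_row P) (dim_row P) (\<lambda>(p, q).
     \<Sum>(i, j) \<in> {(i, j). 1 \<le> i \<and> i < j \<and> j \<le> T - 1}.
       sig_increment T P z i $ p * sig_increment T P z j $ q)"

definition signature_rep :: "nat \<Rightarrow> real mat \<Rightarrow> (nat \<Rightarrow> real vec) \<Rightarrow> real vec" where
  "signature_rep T P z = sig1 T P z @\<^sub>v vectorize (sig2 T P z)"

datatype rep = Pool | Path | Spec | Sig

fun psi ::
  "nat \<Rightarrow> nat \<Rightarrow> real mat \<Rightarrow> ('a \<Rightarrow> nat \<Rightarrow> real vec) \<Rightarrow> rep \<Rightarrow> 'a \<Rightarrow> real vec"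
where
  "psi d T P Z Pool x = pooled d T (Z x)"
| "psi d T P Z Path x = path_rep d T (Z x)"
| "psi d T P Z Spec x = spectral_rep d T (Z x)"
| "psi d T P Z Sig x = signature_rep T P (Z x)"

fun rep_dim :: "nat \<Rightarrow> nat \<Rightarrow> nat \<Rightarrow> rep \<Rightarrow> nat" where
  "rep_dim d T r Pool = d"
| "rep_dim d T r Path = (2 * d + 1) * T"
| "rep_dim d T r Spec = d * T"
| "rep_dim d T r Sig = r + r * r"

(* e is the vector that the chosen convention assigns to the zero vector *)
definition normalized :: "real vec \<Rightarrow> real vec \<Rightarrow> real vec" where
  "normalized e v = (if v = 0\<^sub>v (dim_vec v) then e else (1 / l2_norm v) \<cdot>\<^sub>v v)"

definition gaussian_mixture_kernel ::
  "nat \<Rightarrow> (nat \<Rightarrow> real) \<Rightarrow> real vec \<Rightarrow> ('a \<Rightarrow> real vec) \<Rightarrow> 'a \<Rightarrow> 'a \<Rightarrow> real"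
where
  "gaussian_mixture_kernel M \<sigma> e \<psi> x x' =
     (1 / real M) * (\<Sum>m=1..M.
       exp (- ((l2_norm (normalized e (\<psi> x) - normalized e (\<psi> x')))\<^sup>2 / (\<sigma> m)\<^sup>2)))"

definition rep_kernel ::
  "nat \<Rightarrow> nat \<Rightarrow> real mat \<Rightarrow> ('a \<Rightarrow> nat \<Rightarrow> real vec) \<Rightarrow> (rep \<Rightarrow> real vec) \<Rightarrow>
    nat \<Rightarrow> (rep \<Rightarrow> nat \<Rightarrow> real) \<Rightarrow> rep \<Rightarrow> 'a \<Rightarrow> 'a \<Rightarrow> real"
where
  "rep_kernel d T P Z e M \<sigma> a = gaussian_mixture_kernel M (\<sigma> a) (e a) (psi d T P Z a)"

definition k_CPDA ::
  "nat \<Rightarrow> nat \<Rightarrow> real mat \<Rightarrow> ('a \<Rightarrow> nat \<Rightarrow> real vec) \<Rightarrow> (rep \<Rightarrow> real vec) \<Rightarrow>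
    nat \<Rightarrow> (rep \<Rightarrow> nat \<Rightarrow> real) \<Rightarrow> (rep \<Rightarrow> real) \<Rightarrow> 'a \<Rightarrow> 'a \<Rightarrow> real"
where
  "k_CPDA d T P Z e M \<sigma> \<alpha> x x' =
     \<alpha> Sig * rep_kernel d T P Z e M \<sigma> Sig x x' +
     \<alpha> Spec * rep_kernel d T P Z e M \<sigma> Spec x x' +
     \<alpha> Path * rep_kernel d T P Z e M \<sigma> Path x x' +
     \<alpha> Pool * rep_kernel d T P Z e M \<sigma> Pool x x'"

definition psd_kernel_on :: "'a set \<Rightarrow> ('a \<Rightarrow> 'a \<Rightarrow> real) \<Rightarrow> bool" where
  "psd_kernel_on X k \<longleftrightarrow>
     (\<forall>x\<in>X. \<forall>y\<in>X. k x y = k y x) \<and>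
     (\<forall>n (xs :: nat \<Rightarrow> 'a) (c :: nat \<Rightarrow> real).
        (\<forall>i<n. xs i \<in> X) \<longrightarrow> (\<Sum>i<n. \<Sum>j<n. c i * c j * k (xs i) (xs j)) \<ge> 0)"

end

theory Submission
  imports Defs
begin

text \<open>For vectors of one common dimension,
  $\exp(-\|u-v\|^2/s^2) = \exp(-\|u\|^2/s^2)\,\exp(-\|v\|^2/s^2)\,\exp(2\langle u,v\rangle/s^2)$.
  Positive semidefiniteness is stable under nonnegative combinations, pointwise limits and
  multiplication by $f(x) f(y)$.  Hence it is stable under multiplication by
  $\langle u,v\rangle = \sum_a u_a v_a$, so the power series of the last factor has positive
  semidefinite terms; no general Schur product theorem is needed.\<close>

lemma psd_kernel_onI:
  assumes "\<And>x y. x \<in> X \<Longrightarrow> y \<in> X \<Longrightarrow> k x y = k y x"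
    and "\<And>n (xs :: nat \<Rightarrow> 'a) c. \<forall>i<n. xs i \<in> X \<Longrightarrow>
      (\<Sum>i<n. \<Sum>j<n. c i * c j * k (xs i) (xs j)) \<ge> 0"
  shows "psd_kernel_on X k"
  using assms by (simp add: psd_kernel_on_def)

lemma psd_kernel_on_sym:
  "psd_kernel_on X k \<Longrightarrow> x \<in> X \<Longrightarrow> y \<in> X \<Longrightarrow> k x y = k y x"
  by (simp add: psd_kernel_on_def)

lemma psd_kernel_on_nonneg:
  fixes xs :: "nat \<Rightarrow> 'a"
  shows "psd_kernel_on X k \<Longrightarrow> \<forall>i<n. xs i \<in> X \<Longrightarrow>
    (\<Sum>i<n. \<Sum>j<n. c i * c j * k (xs i) (xs j)) \<ge> 0"
  by (simp add: psd_kernel_on_def)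

text \<open>Agreement is asked for on \<open>X\<close> alone because the later vector identities
  rest on dimension assumptions that hold only for points of \<open>X\<close>.\<close>

lemma psd_kernel_on_cong:
  assumes "psd_kernel_on X k" and "\<And>x y. x \<in> X \<Longrightarrow> y \<in> X \<Longrightarrow> k' x y = k x y"
  shows "psd_kernel_on X k'"
proof (rule psd_kernel_onI)
  show "k' x y = k' y x" if "x \<in> X" "y \<in> X" for x y
    using that assms(2) psd_kernel_on_sym[OF assms(1)] by simp
next
  fix n :: nat and xs :: "nat \<Rightarrow> 'a" and c :: "nat \<Rightarrow> real"
  assume xs: "\<forall>i<n. xs i \<in> X"
  then show "(\<Sum>i<n. \<Sum>j<n. c i * c j * k' (xs i) (xs j)) \<ge> 0"
    using psd_kernel_on_nonneg[OF assms(1) xs, of c] xs by (simp add: assms(2))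
qed

lemma psd_kernel_on_1: "psd_kernel_on X (\<lambda>x y. 1)"
proof (rule psd_kernel_onI)
  fix n :: nat and c :: "nat \<Rightarrow> real"
  show "(\<Sum>i<n. \<Sum>j<n. c i * c j * 1) \<ge> 0"
    \<comment> \<open>The double sum factors as the square of the sum of the
      \<open>c i\<close>.\<close>
    by (simp flip: sum_product)
qed simp

lemma psd_kernel_on_add:
  assumes "psd_kernel_on X k" and "psd_kernel_on X l"
  shows "psd_kernel_on X (\<lambda>x y. k x y + l x y)"
proof (rule psd_kernel_onI)
  show "k x y + l x y = k y x + l y x" if "x \<in> X" "y \<in> X" for x y
    using that assms[THEN psd_kernel_on_sym] by simp
next
  fix n :: nat and xs :: "nat \<Rightarrow> 'a" and c :: "nat \<Rightarrow> real"
  assume xs: "\<forall>i<n. xs i \<in> X"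
  show "(\<Sum>i<n. \<Sum>j<n. c i * c j * (k (xs i) (xs j) + l (xs i) (xs j))) \<ge> 0"
    using psd_kernel_on_nonneg[OF assms(1) xs, of c] psd_kernel_on_nonneg[OF assms(2) xs, of c]
    by (simp add: distrib_left sum.distrib)
qed

text \<open>The weights are absorbed into the coefficients: \<open>c i\<close> becomes
  \<open>c i * f (xs i)\<close>.\<close>

lemma psd_kernel_on_weighted:
  assumes "psd_kernel_on X k"
  shows "psd_kernel_on X (\<lambda>x y. f x * f y * k x y)"
proof (rule psd_kernel_onI)
  show "f x * f y * k x y = f y * f x * k y x" if "x \<in> X" "y \<in> X" for x y
    using that psd_kernel_on_sym[OF assms] by (simp add: mult.commute)
next
  fix n :: nat and xs :: "nat \<Rightarrow> 'a" and c :: "nat \<Rightarrow> real"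
  assume xs: "\<forall>i<n. xs i \<in> X"
  show "(\<Sum>i<n. \<Sum>j<n. c i * c j * (f (xs i) * f (xs j) * k (xs i) (xs j))) \<ge> 0"
    using psd_kernel_on_nonneg[OF assms xs, of "\<lambda>i. c i * f (xs i)"]
    by (simp add: mult_ac)
qed

lemma psd_kernel_on_scale:
  assumes "psd_kernel_on X k" and "a \<ge> 0"
  shows "psd_kernel_on X (\<lambda>x y. a * k x y)"
  \<comment> \<open>A nonnegative scalar is the constant weight \<open>sqrt a\<close> applied on
    both sides.\<close>
  using psd_kernel_on_weighted[OF assms(1), of "\<lambda>_. sqrt a"] assms(2) by simp

lemma psd_kernel_on_sum:
  assumes "\<And>s. s \<in> S \<Longrightarrow> psd_kernel_on X (k s)"
  shows "psd_kernel_on X (\<lambda>x y. \<Sum>s\<in>S. k s x y)"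
  using assms
proof (induction S rule: infinite_finite_induct)
  case (insert s S)
  then show ?case
    using psd_kernel_on_add[of X "k s" "\<lambda>x y. \<Sum>s\<in>S. k s x y"] by simp
\<comment> \<open>For empty or infinite \<open>S\<close> the sum is 0, and the zero kernel is the
  constant 1 scaled by 0.\<close>
qed (use psd_kernel_on_scale[OF psd_kernel_on_1, of 0 X] in simp_all)

text \<open>For a fixed finite family the quadratic form is a finite sum, so it passes to the limit
  and stays nonnegative; symmetry follows from uniqueness of limits.\<close>

lemma psd_kernel_on_LIMSEQ:
  assumes psd: "\<And>N :: nat. psd_kernel_on X (k N)"
    and lim: "\<And>x y. x \<in> X \<Longrightarrow> y \<in> X \<Longrightarrow> (\<lambda>N. k N x y) \<longlonglongrightarrow> l x y"
  shows "psd_kernel_on X l"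
proof (rule psd_kernel_onI)
  fix x y assume "x \<in> X" "y \<in> X"
  then show "l x y = l y x"
    using LIMSEQ_unique[OF lim[of x y]] lim[of y x] psd_kernel_on_sym[OF psd, of x y]
    by simp
next
  fix n :: nat and xs :: "nat \<Rightarrow> 'a" and c :: "nat \<Rightarrow> real"
  assume xs: "\<forall>i<n. xs i \<in> X"
  have "(\<lambda>N. \<Sum>i<n. \<Sum>j<n. c i * c j * k N (xs i) (xs j))
      \<longlonglongrightarrow> (\<Sum>i<n. \<Sum>j<n. c i * c j * l (xs i) (xs j))"
    by (intro tendsto_sum tendsto_mult_left lim) (use xs in simp_all)
  then show "(\<Sum>i<n. \<Sum>j<n. c i * c j * l (xs i) (xs j)) \<ge> 0"
    by (rule LIMSEQ_le_const) (use psd_kernel_on_nonneg[OF psd xs] in blast)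
qed

lemma psd_kernel_on_mult_scalar_prod:
  assumes "psd_kernel_on X k" and "\<And>x. x \<in> X \<Longrightarrow> f x \<in> carrier_vec n"
  shows "psd_kernel_on X (\<lambda>x y. (f x \<bullet> f y) * k x y)"
proof (rule psd_kernel_on_cong)
  show "psd_kernel_on X (\<lambda>x y. \<Sum>a<n. f x $ a * f y $ a * k x y)"
    by (intro psd_kernel_on_sum psd_kernel_on_weighted assms)
  show "(f x \<bullet> f y) * k x y = (\<Sum>a<n. f x $ a * f y $ a * k x y)"
    if "x \<in> X" "y \<in> X" for x y
    \<comment> \<open>\<open>scalar_prod\<close> takes its index range from the second argument, so
      the dimension of \<open>f y\<close> turns it into a sum over \<open>a < n\<close>.\<close>
    using assms(2)[OF that(2)]
    by (simp add: scalar_prod_def sum_distrib_right atLeast0LessThan)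
qed

lemma psd_kernel_on_exp_scalar_prod:
  assumes f: "\<And>x. x \<in> X \<Longrightarrow> f x \<in> carrier_vec n" and "b \<ge> 0"
  shows "psd_kernel_on X (\<lambda>x y. exp (b * (f x \<bullet> f y)))"
proof (rule psd_kernel_on_LIMSEQ)
  have power: "psd_kernel_on X (\<lambda>x y. (f x \<bullet> f y) ^ m)" for m
  proof (induction m)
    case (Suc m)
    then show ?case
      using psd_kernel_on_mult_scalar_prod[OF _ f] by simp
  qed (simp add: psd_kernel_on_1)
  show "psd_kernel_on X (\<lambda>x y. \<Sum>m<N. (b ^ m / fact m) * (f x \<bullet> f y) ^ m)" for N
    \<comment> \<open>The sign of \<open>b\<close> makes every Taylor coefficient
      \<open>b ^ m / fact m\<close> nonnegative.\<close>
    using \<open>b \<ge> 0\<close> by (intro psd_kernel_on_sum psd_kernel_on_scale power) simp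
  show "(\<lambda>N. \<Sum>m<N. (b ^ m / fact m) * (f x \<bullet> f y) ^ m) \<longlonglongrightarrow> exp (b * (f x \<bullet> f y))" for x y
    using exp_converges[of "b * (f x \<bullet> f y)"]
    by (simp add: sums_def power_mult_distrib divide_inverse mult_ac)
qed

lemma l2_norm_minus_power2:
  assumes "u \<in> carrier_vec n" "v \<in> carrier_vec n"
  shows "(l2_norm (u - v))\<^sup>2 = u \<bullet> u + v \<bullet> v - 2 * (u \<bullet> v)"
proof -
  \<comment> \<open>Squaring undoes the \<open>sqrt\<close> in \<open>l2_norm\<close> only for a
    nonnegative argument.\<close>
  have "(u - v) \<bullet> (u - v) \<ge> 0"
    by (simp add: scalar_prod_def sum_nonneg)
  then have "(l2_norm (u - v))\<^sup>2 = (u - v) \<bullet> (u - v)"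
    by (simp add: l2_norm_def)
  also have "\<dots> = u \<bullet> u + v \<bullet> v - 2 * (u \<bullet> v)"
    using assms
    by (simp add: minus_scalar_prod_distrib scalar_prod_minus_distrib
        comm_scalar_prod[of v n u])
  finally show ?thesis .
qed

text \<open>The factorization of the exponential also covers \<open>s = 0\<close>: division by zero
  gives 0 there, and both sides equal 1.\<close>

lemma psd_kernel_on_gaussian:
  assumes f: "\<And>x. x \<in> X \<Longrightarrow> f x \<in> carrier_vec n"
  shows "psd_kernel_on X (\<lambda>x y. exp (- ((l2_norm (f x - f y))\<^sup>2 / s\<^sup>2)))"
proof (rule psd_kernel_on_cong)
  let ?g = "\<lambda>x. exp (- (f x \<bullet> f x) / s\<^sup>2)"
  show "psd_kernel_on X (\<lambda>x y. ?g x * ?g y * exp (2 / s\<^sup>2 * (f x \<bullet> f y)))"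
    by (intro psd_kernel_on_weighted psd_kernel_on_exp_scalar_prod[of X f n] f) simp_all
  show "exp (- ((l2_norm (f x - f y))\<^sup>2 / s\<^sup>2)) = ?g x * ?g y * exp (2 / s\<^sup>2 * (f x \<bullet> f y))"
    if "x \<in> X" "y \<in> X" for x y
    unfolding l2_norm_minus_power2[OF f f, OF that] exp_add[symmetric]
    by (simp add: diff_divide_distrib add_divide_distrib)
qed

lemma normalized_carrier:
  "e \<in> carrier_vec n \<Longrightarrow> v \<in> carrier_vec n \<Longrightarrow> normalized e v \<in> carrier_vec n"
  by (simp add: normalized_def)

text \<open>Each summand is a Gaussian kernel of the single feature map
  \<open>\<lambda>x. normalized e (\<psi> x)\<close>, whose values share the dimension
  \<open>n\<close> even where the convention vector \<open>e\<close> is used.\<close>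

lemma psd_kernel_on_gaussian_mixture:
  assumes "e \<in> carrier_vec n" and "\<And>x. x \<in> X \<Longrightarrow> \<psi> x \<in> carrier_vec n"
  shows "psd_kernel_on X (gaussian_mixture_kernel M \<sigma> e \<psi>)"
  unfolding gaussian_mixture_kernel_def
  by (intro psd_kernel_on_scale psd_kernel_on_sum psd_kernel_on_gaussian[of X _ n]
      normalized_carrier assms) simp_all

lemma dim_vec_vectorize: "dim_vec (vectorize A) = dim_row A * dim_col A"
  by (simp only: vectorize_def dim_vec)

lemma dim_dft: "dim_row (dft d T z) = d" "dim_col (dft d T z) = T"
  by (simp_all only: dft_def dim_row_mat dim_col_mat)

lemma dim_sig1: "dim_vec (sig1 T P z) = dim_row P"
  by (simp only: sig1_def dim_vec)

lemma dim_sig2: "dim_row (sig2 T P z) = dim_row P" "dim_col (sig2 T P z) = dim_row P"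
  by (simp_all only: sig2_def dim_row_mat dim_col_mat)

text \<open>All that positive semidefiniteness requires of the four representations is a length
  independent of \<open>x\<close>.\<close>

lemma psi_carrier:
  assumes "P \<in> carrier_mat r n"
  shows "psi d T P Z a x \<in> carrier_vec (rep_dim d T r a)"
proof (rule carrier_vecI, cases a)
  case Pool
  then show "dim_vec (psi d T P Z a x) = rep_dim d T r a"
    by (simp only: psi.simps rep_dim.simps pooled_def dim_vec)
next
  case Path
  then show "dim_vec (psi d T P Z a x) = rep_dim d T r a"
    \<comment> \<open>The list \<open>[1..<T + 1]\<close> has \<open>T\<close> entries, so the
      matrix has \<open>T\<close> columns.\<close>
    by (simp add: path_rep_def dim_vec_vectorize)
next
  case Spec
  then show "dim_vec (psi d T P Z a x) = rep_dim d T r a"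
    by (simp add: spectral_rep_def dim_vec_vectorize dim_dft)
next
  case Sig
  then show "dim_vec (psi d T P Z a x) = rep_dim d T r a"
    using assms by (simp add: signature_rep_def dim_vec_vectorize dim_sig1 dim_sig2)
qed

theorem proposition1:
  fixes X :: "real mat set"
    and Z :: "real mat \<Rightarrow> nat \<Rightarrow> real vec"
    and P :: "real mat"
    and e :: "rep \<Rightarrow> real vec"
    and \<sigma> :: "rep \<Rightarrow> nat \<Rightarrow> real"
    and \<alpha> :: "rep \<Rightarrow> real"
    and Cin L d T r M :: nat
  assumes "X \<subseteq> carrier_mat Cin L"
    and "T \<ge> 1"
    and "\<And>x t. x \<in> X \<Longrightarrow> 1 \<le> t \<Longrightarrow> t \<le> T \<Longrightarrow> Z x t \<in> carrier_vec d"
    and "P \<in> carrier_mat r (d + 1)"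
    and "\<And>a. e a \<in> carrier_vec (rep_dim d T r a)"
    and "M \<ge> 1"
    and "\<And>a m. 1 \<le> m \<Longrightarrow> m \<le> M \<Longrightarrow> \<sigma> a m > 0"
    and "\<And>a. \<alpha> a \<ge> 0"
  shows "psd_kernel_on X (k_CPDA d T P Z e M \<sigma> \<alpha>)"
proof -
  \<comment> \<open>One argument serves all four representations: \<open>e a\<close> and the values
    of \<open>psi\<close> lie in the same space, of dimension
    \<open>rep_dim d T r a\<close>.\<close>
  have "psd_kernel_on X (rep_kernel d T P Z e M \<sigma> a)" for a
    unfolding rep_kernel_def
    by (rule psd_kernel_on_gaussian_mixture[OF assms(5) psi_carrier[OF assms(4)]])
  then have "psd_kernel_on X (\<lambda>x y. \<alpha> a * rep_kernel d T P Z e M \<sigma> a x y)" for a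
    by (rule psd_kernel_on_scale) (rule assms(8))
  then show ?thesis
    unfolding k_CPDA_def by (intro psd_kernel_on_add)
qed

end
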